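(* Let $P$ be a $d$-dimensional $k\times\cdots\times k$ permutation matrix or a tuple permutation matrix generated by such a permutation matrix. Then $I(P,d)\ge d(k-1)$. Furthermore, if $P$ is the $d$-dimensional $k\times\cdots\times k$ identity matrix, then $I(P,d)=S(P,d)=d(k-1)$.
   Context: A $d$-dimensional $n_1\times\cdots\times n_d$ zero-one matrix is an array $A=(a_{i_1,\ldots,i_d})$, $1\le i_\ell\le n_\ell$, with entries in $\{0,1\}$. A submatrix is obtained by selecting, for each $\ell$, a set of values of the $\ell$-th coordinate (keeping the order). $A$ contains a $d$-dimensional zero-one matrix $B$ if some submatrix of $A$ can be transformed into $B$ by changing any number of ones to zeros; otherwise $A$ avoids $B$. $f(n,B,d)$ denotes the maximum number of ones in a $d$-dimensional $n\times\cdots\times n$ zero-one matrix that avoids $B$, and $$I(P,d)=\liminf_{n\to\infty}\frac{f(n,P,d)}{n^{d-1}},\qquad S(P,d)=\limsup_{n\to\infty}\frac{f(n,P,d)}{n^{d-1}}.$$ An $\ell$-cross section is the set of all entries having a fixed value of the $\ell$-th coordinate. A $d$-dimensional $k\times\cdots\times k$ zero-one matrix is a permutation matrix if each of its $\ell$-cross sections contains exactly one nonzero entry, for every $\ell=1,\ldots,d$. The identity matrix has $p_{i_1,\ldots,i_d}=1$ if $i_1=\cdots=i_d$ and $0$ otherwise. $R^{k_1,\ldots,k_d}$ is the $k_1\times\cdots\times k_d$ matrix of all ones, and the Kronecker product $M\otimes N$ is obtained by replacing each $1$-entry of $M$ by a copy of $N$ and each $0$-entry of $M$ by a zero matrix of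 the same size as $N$. A tuple permutation matrix generated by a permutation matrix $P'$ is a matrix $P'\otimes R^{k_1,\ldots,k_d}$ in which exactly one of $k_1,\ldots,k_d$ is larger than $1$ and the rest equal $1$. *)

theory Defs
  imports Complex_Main "HOL-Library.FuncSet" "HOL-Library.Extended_Real" "HOL-Library.Liminf_Limsup"
begin

text \<open>Coordinates and indices are numbered from 0: a position of an
  \<open>n\<^sub>1 \<times> \<dots> \<times> n\<^sub>d\<close> matrix is an extensional function \<open>i\<close> on \<open>{..<d}\<close> with \<open>i l < n l\<close>.\<close>

definition positions :: "nat \<Rightarrow> (nat \<Rightarrow> nat) \<Rightarrow> (nat \<Rightarrow> nat) set" where
  "positions d n = (\<Pi>\<^sub>E l\<in>{..<d}. {..<n l})"

datatype matrix = Matrix (dims: "nat \<Rightarrow> nat") (entry: "(nat \<Rightarrow> nat) \<Rightarrow> nat")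

text \<open>Side lengths and entries are extensional, so that equality of matrices is HOL equality
  and there are only finitely many zero-one matrices of a given size.\<close>

definition zero_one_matrices :: "nat \<Rightarrow> (nat \<Rightarrow> nat) \<Rightarrow> matrix set" where
  "zero_one_matrices d n =
     {A. dims A = restrict n {..<d} \<and> entry A \<in> positions d n \<rightarrow>\<^sub>E {0, 1}}"

definition num_ones :: "nat \<Rightarrow> matrix \<Rightarrow> nat" where
  "num_ones d A = card {i \<in> positions d (dims A). entry A i = 1}"

text \<open>\<open>S l\<close> is the set of selected values of the \<open>l\<close>-th coordinate; these are renumbered in
  increasing order.\<close>

definition submatrix :: "nat \<Rightarrow> matrix \<Rightarrow> (nat \<Rightarrow> nat set) \<Rightarrow> matrix" where
  "submatrix d A S =
     Matrix (\<lambda>l\<in>{..<d}. card (S l))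
       (\<lambda>i\<in>positions d (\<lambda>l. card (S l)).
          entry A (\<lambda>l\<in>{..<d}. sorted_list_of_set (S l) ! i l))"

text \<open>\<open>B\<close> arises from \<open>C\<close> by changing any number of ones to zeros.\<close>

definition ones_to_zeros :: "nat \<Rightarrow> matrix \<Rightarrow> matrix \<Rightarrow> bool" where
  "ones_to_zeros d C B \<longleftrightarrow>
     (\<forall>l<d. dims C l = dims B l) \<and>
     (\<forall>i\<in>positions d (dims C). entry B i = entry C i \<or> (entry C i = 1 \<and> entry B i = 0))"

definition contains :: "nat \<Rightarrow> matrix \<Rightarrow> matrix \<Rightarrow> bool" where
  "contains d A B \<longleftrightarrow>
     (\<exists>S. (\<forall>l<d. S l \<subseteq> {..<dims A l}) \<and> ones_to_zeros d (submatrix d A S) B)"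

abbreviation avoids :: "nat \<Rightarrow> matrix \<Rightarrow> matrix \<Rightarrow> bool" where
  "avoids d A B \<equiv> \<not> contains d A B"

text \<open>\<open>f(n, B, d)\<close>. The set is finite, and nonempty whenever \<open>B\<close> has a nonzero entry.\<close>

definition extremal :: "nat \<Rightarrow> matrix \<Rightarrow> nat \<Rightarrow> nat" where
  "extremal n B d = Max (num_ones d ` {A \<in> zero_one_matrices d (\<lambda>_. n). avoids d A B})"

text \<open>\<open>I(P, d)\<close> and \<open>S(P, d)\<close>, as extended reals.\<close>

definition lower_limit :: "matrix \<Rightarrow> nat \<Rightarrow> ereal" where
  "lower_limit P d = liminf (\<lambda>n. ereal (real (extremal n P d) / real n ^ (d - 1)))"

definition upper_limit :: "matrix \<Rightarrow> nat \<Rightarrow> ereal" where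
  "upper_limit P d = limsup (\<lambda>n. ereal (real (extremal n P d) / real n ^ (d - 1)))"

definition cross_section :: "nat \<Rightarrow> matrix \<Rightarrow> nat \<Rightarrow> nat \<Rightarrow> (nat \<Rightarrow> nat) set" where
  "cross_section d A l v = {i \<in> positions d (dims A). i l = v}"

definition permutation_matrix :: "nat \<Rightarrow> nat \<Rightarrow> matrix \<Rightarrow> bool" where
  "permutation_matrix d k P \<longleftrightarrow>
     P \<in> zero_one_matrices d (\<lambda>_. k) \<and>
     (\<forall>l<d. \<forall>v<k. \<exists>!i. i \<in> cross_section d P l v \<and> entry P i \<noteq> 0)"

definition identity_matrix :: "nat \<Rightarrow> nat \<Rightarrow> matrix" where
  "identity_matrix d k =
     Matrix (\<lambda>l\<in>{..<d}. k)
       (\<lambda>i\<in>positions d (\<lambda>_. k). if \<forall>l<d. \<forall>l'<d. i l = i l' then 1 else 0)"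

definition ones_matrix :: "nat \<Rightarrow> (nat \<Rightarrow> nat) \<Rightarrow> matrix" where
  "ones_matrix d q = Matrix (restrict q {..<d}) (\<lambda>i\<in>positions d q. 1)"

text \<open>In the Kronecker product, position \<open>i\<close> lies in the block of \<open>M\<close> with coordinates
  \<open>i l div dims N l\<close>, at offset \<open>i l mod dims N l\<close> within that block.\<close>

definition kronecker :: "nat \<Rightarrow> matrix \<Rightarrow> matrix \<Rightarrow> matrix" where
  "kronecker d M N =
     Matrix (\<lambda>l\<in>{..<d}. dims M l * dims N l)
       (\<lambda>i\<in>positions d (\<lambda>l. dims M l * dims N l).
          if entry M (\<lambda>l\<in>{..<d}. i l div dims N l) = 1
          then entry N (\<lambda>l\<in>{..<d}. i l mod dims N l)
          else 0)"

definition tuple_permutation_matrix :: "nat \<Rightarrow> matrix \<Rightarrow> matrix \<Rightarrow> bool" where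
  "tuple_permutation_matrix d P' P \<longleftrightarrow>
     (\<exists>q. (\<exists>l<d. q l > 1 \<and> (\<forall>j<d. j \<noteq> l \<longrightarrow> q j = 1)) \<and>
          P = kronecker d P' (ones_matrix d q))"

end

theory Submission
  imports Defs
begin

text \<open>Lower bound: fix a one of \<open>P\<close> at position \<open>p\<close>. An occurrence of \<open>P\<close> needs room for \<open>p l\<close>
  smaller and \<open>dims P l - 1 - p l\<close> larger indices in each direction \<open>l\<close>, so the matrix whose zeros
  form exactly the box of admissible images of \<open>p\<close> avoids \<open>P\<close>; it has at least
  \<open>n^d - (n - k + 1)^d\<close> ones.
  Upper bound: if \<open>P\<close> is the identity, each of the \<open>n^d - (n - 1)^d\<close> lines in direction
  \<open>(1, \<dots>, 1)\<close> carries at most \<open>k - 1\<close> ones of a matrix avoiding \<open>P\<close>.\<close>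

section \<open>Estimates for differences of powers\<close>

text \<open>The difference factors as \<open>a - b\<close> times a sum of \<open>d\<close> monomials
  of degree \<open>d - 1\<close> in \<open>a\<close> and \<open>b\<close>, each at least
  \<open>b ^ (d - 1)\<close>.\<close>

lemma power_diff_ge:
  fixes a b :: real
  assumes "0 \<le> b" "b \<le> a"
  shows "real d * (a - b) * b ^ (d - 1) \<le> a ^ d - b ^ d"
proof -
  have "real (card {..<d}) * b ^ (d - 1) \<le> (\<Sum>i<d. b ^ (d - Suc i) * a ^ i)"
  proof (rule sum_bounded_below)
    fix i assume "i \<in> {..<d}"
    then have "b ^ (d - 1) = b ^ (d - Suc i) * b ^ i"
      by (simp flip: power_add)
    also have "\<dots> \<le> b ^ (d - Suc i) * a ^ i"
      using assms by (intro mult_left_mono power_mono) auto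
    finally show "b ^ (d - 1) \<le> b ^ (d - Suc i) * a ^ i" .
  qed
  then have "(a - b) * (real d * b ^ (d - 1)) \<le> (a - b) * (\<Sum>i<d. b ^ (d - Suc i) * a ^ i)"
    using assms by (intro mult_left_mono) auto
  then show ?thesis
    by (simp add: power_diff_sumr2 mult_ac)
qed

lemma power_diff_le:
  fixes a b :: real
  assumes "0 \<le> b" "b \<le> a"
  shows "a ^ d - b ^ d \<le> real d * (a - b) * a ^ (d - 1)"
proof -
  have "(\<Sum>i<d. b ^ (d - Suc i) * a ^ i) \<le> real (card {..<d}) * a ^ (d - 1)"
  proof (rule sum_bounded_above)
    fix i assume "i \<in> {..<d}"
    then have "a ^ (d - 1) = a ^ (d - Suc i) * a ^ i"
      by (simp flip: power_add)
    moreover have "b ^ (d - Suc i) * a ^ i \<le> a ^ (d - Suc i) * a ^ i"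
      using assms by (intro mult_right_mono power_mono) auto
    ultimately show "b ^ (d - Suc i) * a ^ i \<le> a ^ (d - 1)" by simp
  qed
  then have "(a - b) * (\<Sum>i<d. b ^ (d - Suc i) * a ^ i) \<le> (a - b) * (real d * a ^ (d - 1))"
    using assms by (intro mult_left_mono) auto
  then show ?thesis
    by (simp add: power_diff_sumr2 mult_ac)
qed

section \<open>Increasing enumerations of finite sets of naturals\<close>

lemma strict_sorted_nth_add_le:
  fixes xs :: "nat list"
  assumes "sorted_wrt (<) xs" "j + t < length xs"
  shows "xs ! j + t \<le> xs ! (j + t)"
  using assms(2)
proof (induction t)
  case (Suc t)
  have "xs ! (j + t) < xs ! (j + Suc t)"
    using assms(1) Suc.prems by (intro sorted_wrt_nth_less) auto
  with Suc show ?case by simp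
qed simp

text \<open>Below the \<open>j\<close>-th element lie \<open>j\<close> elements of \<open>S\<close>,
  and above it \<open>card S - 1 - j\<close>, all of them in \<open>{..<n}\<close>. The second bound
  is kept additive to avoid truncated subtraction.\<close>

lemma sorted_list_of_set_nth_bounds:
  fixes S :: "nat set"
  assumes "S \<subseteq> {..<n}" "j < card S"
  shows "j \<le> sorted_list_of_set S ! j" "sorted_list_of_set S ! j + card S \<le> n + j"
proof -
  let ?xs = "sorted_list_of_set S"
  have fin: "finite S" using assms(1) finite_subset by blast
  have sorted: "sorted_wrt (<) ?xs" by simp
  show "j \<le> ?xs ! j"
    using strict_sorted_nth_add_le[OF sorted, of 0 j] assms(2) fin by simp
  have "?xs ! (card S - 1) \<in> set ?xs"
    using assms(2) fin by (intro nth_mem) simp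
  then have "?xs ! (card S - 1) < n"
    using assms(1) fin by auto
  with strict_sorted_nth_add_le[OF sorted, of j "card S - 1 - j"] assms(2) fin
  show "?xs ! j + card S \<le> n + j" by simp
qed

text \<open>Lets one set of step lengths, shifted by a different base in each coordinate, be
  enumerated in parallel; this is how points of a diagonal line are selected.\<close>

lemma sorted_list_of_set_translation:
  fixes T :: "nat set"
  assumes "finite T"
  shows "sorted_list_of_set ((+) c ` T) = map ((+) c) (sorted_list_of_set T)"
proof (rule sorted_distinct_set_unique)
  show "sorted (map ((+) c) (sorted_list_of_set T))"
    by (auto simp: sorted_map intro: sorted_wrt_mono_rel[OF _ sorted_sorted_list_of_set])
qed (use assms in \<open>auto simp: distinct_map\<close>)

section \<open>Positions and zero-one matrices of a given size\<close>

lemma finite_positions: "finite (positions d n)"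
  unfolding positions_def by (intro finite_PiE) auto

lemma finite_zero_one_matrices: "finite (zero_one_matrices d n)"
proof -
  have "zero_one_matrices d n \<subseteq> Matrix (restrict n {..<d}) ` (positions d n \<rightarrow>\<^sub>E {0, 1})"
    unfolding zero_one_matrices_def by (force intro: matrix.expand)
  moreover have "finite (positions d n \<rightarrow>\<^sub>E {0, 1::nat})"
    by (intro finite_PiE finite_positions) auto
  ultimately show ?thesis by (meson finite_imageI finite_subset)
qed

lemma positions_cong: "(\<And>l. l < d \<Longrightarrow> m l = n l) \<Longrightarrow> positions d m = positions d n"
  unfolding positions_def by (intro PiE_cong) auto

lemma zero_one_matricesD:
  assumes "A \<in> zero_one_matrices d n"
  shows "\<And>l. l < d \<Longrightarrow> dims A l = n l"
    and "positions d (dims A) = positions d n"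
    and "\<And>i. i \<in> positions d n \<Longrightarrow> entry A i = 0 \<or> entry A i = 1"
proof -
  show dims: "dims A l = n l" if "l < d" for l
    using assms that by (auto simp: zero_one_matrices_def)
  show "positions d (dims A) = positions d n"
    using dims by (rule positions_cong)
  show "entry A i = 0 \<or> entry A i = 1" if "i \<in> positions d n" for i
    using assms that by (auto simp: zero_one_matrices_def dest!: PiE_mem)
qed

lemma positions_memD: "i \<in> positions d n \<Longrightarrow> l < d \<Longrightarrow> i l < n l"
  unfolding positions_def by auto

section \<open>The extremal construction and the lower bound\<close>

text \<open>\<open>K\<close> stands for the side lengths of the pattern and \<open>p\<close> for the
  position of its chosen one. The condition \<open>i l + K l \<le> n + p l\<close> says that at
  least \<open>K l - 1 - p l\<close> indices remain above \<open>i l\<close>.\<close>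

definition box_complement :: "nat \<Rightarrow> nat \<Rightarrow> (nat \<Rightarrow> nat) \<Rightarrow> (nat \<Rightarrow> nat) \<Rightarrow> matrix" where
  "box_complement d n K p =
     Matrix (\<lambda>l\<in>{..<d}. n)
       (\<lambda>i\<in>positions d (\<lambda>_. n). if \<forall>l<d. p l \<le> i l \<and> i l + K l \<le> n + p l then 0 else 1)"

lemma box_complement_zero_one: "box_complement d n K p \<in> zero_one_matrices d (\<lambda>_. n)"
  by (auto simp: box_complement_def zero_one_matrices_def)

text \<open>The zeros form a box whose size does not depend on \<open>p\<close>. Truncation is
  harmless: if \<open>n < K l\<close>, the side is empty and the factor \<open>n + 1 - K l\<close>
  is 0.\<close>

lemma num_ones_box_complement:
  assumes "\<And>l. l < d \<Longrightarrow> p l < K l"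
  shows "num_ones d (box_complement d n K p) = n ^ d - (\<Prod>l<d. n + 1 - K l)"
proof -
  let ?box = "\<Pi>\<^sub>E l\<in>{..<d}. {p l..<n + p l + 1 - K l}"
  have dims: "positions d (dims (box_complement d n K p)) = positions d (\<lambda>_. n)"
    by (rule zero_one_matricesD[OF box_complement_zero_one])
  \<comment> \<open>\<open>p l < K l\<close> keeps the upper end \<open>n + p l + 1 - K l\<close> at
    most \<open>n\<close>.\<close>
  have sub: "?box \<subseteq> positions d (\<lambda>_. n)"
    unfolding positions_def using assms by (intro PiE_mono) fastforce
  have "{i \<in> positions d (\<lambda>_. n). entry (box_complement d n K p) i = 1}
          = positions d (\<lambda>_. n) - ?box"
  proof -
    have "i \<in> ?box \<longleftrightarrow> (\<forall>l<d. p l \<le> i l \<and> i l + K l \<le> n + p l)"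
      if "i \<in> positions d (\<lambda>_. n)" for i
      using that unfolding positions_def PiE_iff by (simp add: less_diff_conv less_Suc_eq_le Ball_def)
    then show ?thesis by (auto simp: box_complement_def)
  qed
  then have "num_ones d (box_complement d n K p) = card (positions d (\<lambda>_. n)) - card ?box"
    using card_Diff_subset[OF finite_subset[OF sub finite_positions] sub]
    by (simp add: num_ones_def dims)
  also have "card (positions d (\<lambda>_. n)) = n ^ d"
    by (simp add: positions_def card_PiE)
  also have "card ?box = (\<Prod>l<d. n + 1 - K l)"
    by (simp add: card_PiE)
  finally show ?thesis .
qed

lemma box_complement_avoids:
  assumes p: "p \<in> positions d (dims P)" "entry P p = 1"
  shows "avoids d (box_complement d n (dims P) p) P"
proof
  let ?A = "box_complement d n (dims P) p"
  assume "contains d ?A P"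
  then obtain S where S: "\<And>l. l < d \<Longrightarrow> S l \<subseteq> {..<dims ?A l}"
    and otz: "ones_to_zeros d (submatrix d ?A S) P"
    unfolding contains_def by blast
  have card: "card (S l) = dims P l" if "l < d" for l
    using otz that by (simp add: ones_to_zeros_def submatrix_def)
  have Sn: "S l \<subseteq> {..<n}" if "l < d" for l
    using S[OF that] that by (simp add: box_complement_def)
  \<comment> \<open>The entry of the matrix that an occurrence of \<open>P\<close> would match with
    the one at \<open>p\<close>; the bounds place it inside the box of zeros.\<close>
  let ?i = "\<lambda>l\<in>{..<d}. sorted_list_of_set (S l) ! p l"
  have bounds: "p l \<le> ?i l" "?i l + dims P l \<le> n + p l" "p l < dims P l" if "l < d" for l
    using sorted_list_of_set_nth_bounds[OF Sn[OF that], of "p l"] card[OF that]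
      positions_memD[OF p(1) that] that by auto
  have "?i l < n" if "l < d" for l
    using bounds(2,3)[OF that] by linarith
  then have "?i \<in> positions d (\<lambda>_. n)"
    by (simp add: positions_def)
  with bounds have "entry ?A ?i = 0"
    by (auto simp: box_complement_def)
  moreover have "p \<in> positions d (\<lambda>l. card (S l))"
    using p(1) card positions_cong by metis
  moreover have "positions d (dims (submatrix d ?A S)) = positions d (\<lambda>l. card (S l))"
    by (rule positions_cong) (simp add: submatrix_def)
  ultimately show False
    using otz p(2) by (auto simp: ones_to_zeros_def submatrix_def)
qed

lemma extremal_ge:
  assumes "A \<in> zero_one_matrices d (\<lambda>_. n)" "avoids d A P"
  shows "num_ones d A \<le> extremal n P d"
  unfolding extremal_def using assms finite_zero_one_matrices by (intro Max_ge) auto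

text \<open>The one at \<open>p\<close> guarantees, through \<open>box_complement\<close>, that some
  matrix avoids \<open>P\<close>; the maximum is thus over a nonempty set.\<close>

lemma extremal_le:
  assumes "p \<in> positions d (dims P)" "entry P p = 1"
    and "\<And>A. A \<in> zero_one_matrices d (\<lambda>_. n) \<Longrightarrow> avoids d A P \<Longrightarrow> num_ones d A \<le> N"
  shows "extremal n P d \<le> N"
  unfolding extremal_def
  using assms(3) box_complement_avoids[OF assms(1,2), of n]
    box_complement_zero_one[of d n "dims P" p]
  by (subst Max_le_iff) (auto simp: finite_zero_one_matrices)

text \<open>Asking only for a single one and for sides of length at least \<open>k\<close> covers
  permutation matrices, tuple permutation matrices and the identity at once.\<close>

lemma lower_limit_ge:
  assumes p: "p \<in> positions d (dims P)" "entry P p = 1"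
    and dims: "\<And>l. l < d \<Longrightarrow> k \<le> dims P l" and "k \<ge> 1"
  shows "lower_limit P d \<ge> ereal (real d * (real k - 1))"
proof -
  define m where "m = k - 1"
  \<comment> \<open>This is \<open>d * m * (n - m) ^ (d - 1)\<close>, the bound from
    \<open>power_diff_ge\<close>, divided by \<open>n ^ (d - 1)\<close> and written so that its
    limit is visible.\<close>
  define g where "g n = real d * real m * (1 - real m / real n) ^ (d - 1)" for n :: nat
  have "g \<longlonglongrightarrow> real d * real m * (1 - 0) ^ (d - 1)"
    unfolding g_def by (intro tendsto_intros lim_const_over_n)
  then have "(\<lambda>n. ereal (g n)) \<longlonglongrightarrow> ereal (real d * (real k - 1))"
    using \<open>k \<ge> 1\<close> by (simp add: m_def of_nat_diff)
  then have "ereal (real d * (real k - 1)) = liminf (\<lambda>n. ereal (g n))"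
    by (intro lim_imp_Liminf[symmetric]) auto
  also have "\<dots> \<le> lower_limit P d"
    unfolding lower_limit_def
  proof (rule Liminf_mono)
    have "ereal (g n) \<le> ereal (real (extremal n P d) / real n ^ (d - 1))" if n: "n > m" for n
    proof -
      \<comment> \<open>Longer sides of \<open>P\<close> only shrink the box of zeros, so the cube
        of side \<open>n - m\<close> is the worst case.\<close>
      have "(\<Prod>l<d. n + 1 - dims P l) \<le> (\<Prod>l<d. n - m)"
        using dims \<open>k \<ge> 1\<close> by (intro prod_mono) (auto simp: m_def intro!: diff_le_mono2)
      then have "n ^ d - (n - m) ^ d \<le> n ^ d - (\<Prod>l<d. n + 1 - dims P l)"
        by simp
      also have "\<dots> = num_ones d (box_complement d n (dims P) p)"
        using positions_memD[OF p(1)] by (simp add: num_ones_box_complement)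
      also have "\<dots> \<le> extremal n P d"
        by (intro extremal_ge box_complement_zero_one box_complement_avoids p)
      finally have "n ^ d \<le> extremal n P d + (n - m) ^ d"
        by simp
      then have "real (n ^ d) \<le> real (extremal n P d + (n - m) ^ d)"
        by (rule of_nat_mono)
      then have "real n ^ d - (real n - real m) ^ d \<le> real (extremal n P d)"
        using n by (simp add: of_nat_diff)
      moreover have "real d * real m * (real n - real m) ^ (d - 1)
          \<le> real n ^ d - (real n - real m) ^ d"
        using power_diff_ge[of "real n - real m" "real n" d] n by simp
      ultimately have "real d * real m * (real n - real m) ^ (d - 1) / real n ^ (d - 1)
          \<le> real (extremal n P d) / real n ^ (d - 1)"
        by (intro divide_right_mono) auto
      moreover have "1 - real m / real n = (real n - real m) / real n"
        using n by (simp add: diff_divide_distrib)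
      then have "g n = real d * real m * (real n - real m) ^ (d - 1) / real n ^ (d - 1)"
        by (simp add: g_def power_divide)
      ultimately show ?thesis by simp
    qed
    then show "\<forall>\<^sub>F n in sequentially. ereal (g n) \<le> ereal (real (extremal n P d) / real n ^ (d - 1))"
      using eventually_gt_at_top[of m] by (rule eventually_mono[rotated])
  qed
  finally show ?thesis .
qed

section \<open>The upper bound for the identity matrix\<close>

text \<open>Selecting the values \<open>b l + t\<close> with \<open>t \<in> T\<close> in every
  coordinate \<open>l\<close> puts the given ones on the main diagonal of the submatrix. All other
  entries may be arbitrary, since ones there can be changed to zeros.\<close>

lemma contains_identity:
  assumes A: "A \<in> zero_one_matrices d (\<lambda>_. n)" and "d \<ge> 1"
    and T: "finite T" "card T = k"
    and ones: "\<And>t. t \<in> T \<Longrightarrow> (\<lambda>l\<in>{..<d}. b l + t) \<in> positions d (\<lambda>_. n)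
                \<and> entry A (\<lambda>l\<in>{..<d}. b l + t) = 1"
  shows "contains d A (identity_matrix d k)"
  unfolding contains_def
proof (intro exI conjI allI impI)
  let ?S = "\<lambda>l. (+) (b l) ` T"
  have card: "card (?S l) = k" for l
    using T by (simp add: card_image)
  show "?S l \<subseteq> {..<dims A l}" if "l < d" for l
    using positions_memD[OF conjunct1[OF ones] that] zero_one_matricesD(1)[OF A that] that by auto
  have nth: "sorted_list_of_set (?S l) ! j = b l + sorted_list_of_set T ! j" if "j < k" for l j
    using T that by (simp add: sorted_list_of_set_translation)
  have mem: "sorted_list_of_set T ! j \<in> T" if "j < k" for j
    using T that nth_mem[of j "sorted_list_of_set T"] by simp
  show "ones_to_zeros d (submatrix d A ?S) (identity_matrix d k)"
    unfolding ones_to_zeros_def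
  proof (intro conjI allI impI ballI)
    show "dims (submatrix d A ?S) l = dims (identity_matrix d k) l" if "l < d" for l
      using that card by (simp add: submatrix_def identity_matrix_def)
    fix i assume "i \<in> positions d (dims (submatrix d A ?S))"
    moreover have "positions d (dims (submatrix d A ?S)) = positions d (\<lambda>_. k)"
      by (rule positions_cong) (simp add: submatrix_def card)
    ultimately have i: "i \<in> positions d (\<lambda>_. k)" by simp
    then have ik: "i l < k" if "l < d" for l
      using that positions_memD by fastforce
    let ?a = "\<lambda>l\<in>{..<d}. b l + sorted_list_of_set T ! i l"
    have C: "entry (submatrix d A ?S) i = entry A ?a"
      using i ik nth by (simp add: submatrix_def card cong: restrict_cong)
    \<comment> \<open>Off the diagonal \<open>?a\<close> lies on no given line point, so each
      coordinate is bounded separately, using the line point with that coordinate's own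
      step.\<close>
    have "b l + sorted_list_of_set T ! i l < n" if "l < d" for l
      using positions_memD[OF conjunct1[OF ones[OF mem[OF ik[OF that]]]] that] that by simp
    then have "?a \<in> positions d (\<lambda>_. n)"
      by (auto simp: positions_def)
    then have C01: "entry A ?a = 0 \<or> entry A ?a = 1"
      by (rule zero_one_matricesD[OF A])
    show "entry (identity_matrix d k) i = entry (submatrix d A ?S) i \<or>
        entry (submatrix d A ?S) i = 1 \<and> entry (identity_matrix d k) i = 0"
    proof (cases "\<forall>l<d. \<forall>l'<d. i l = i l'")
      case True
      \<comment> \<open>All \<open>i l\<close> agree with \<open>i 0\<close>, so \<open>?a\<close>
        is a point of the line through \<open>b\<close>.\<close>
      then have "?a = (\<lambda>l\<in>{..<d}. b l + sorted_list_of_set T ! i 0)"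
        using \<open>d \<ge> 1\<close> by (intro restrict_ext) (metis less_le_trans lessThan_iff zero_less_one)
      then have "entry A ?a = 1"
        using ones[OF mem[OF ik[of 0]]] \<open>d \<ge> 1\<close> by simp
      moreover have "entry (identity_matrix d k) i = 1"
        using True unfolding identity_matrix_def matrix.sel restrict_apply'[OF i] by (rule if_P)
      ultimately show ?thesis using C by simp
    next
      case False
      then have "entry (identity_matrix d k) i = 0"
        unfolding identity_matrix_def matrix.sel restrict_apply'[OF i] by (rule if_not_P)
      then show ?thesis using C C01 by auto
    qed
  qed
qed

text \<open>Every one lies on a diagonal line through some point with a zero coordinate, and
  \<open>k\<close> ones on a single line would form the identity.\<close>

lemma num_ones_le_if_avoids_identity:
  assumes A: "A \<in> zero_one_matrices d (\<lambda>_. n)" and avoids: "avoids d A (identity_matrix d k)"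
    and "d \<ge> 1" "n \<ge> 1"
  shows "num_ones d A \<le> (n ^ d - (n - 1) ^ d) * (k - 1)"
proof -
  define X where "X = {i \<in> positions d (\<lambda>_. n). entry A i = 1}"
  \<comment> \<open>Points with at least one coordinate 0: the starting points of the diagonal
    lines.\<close>
  define bases where "bases = positions d (\<lambda>_. n) - (\<Pi>\<^sub>E l\<in>{..<d}. {1..<n})"
  define steps where "steps b = {t. (\<lambda>l\<in>{..<d}. b l + t) \<in> X}" for b
  have sub: "(\<Pi>\<^sub>E l\<in>{..<d}. {1..<n}) \<subseteq> positions d (\<lambda>_. n)"
    unfolding positions_def by (intro PiE_mono) auto
  then have card_bases: "card bases = n ^ d - (n - 1) ^ d"
    unfolding bases_def
    by (subst card_Diff_subset) (auto simp: positions_def card_PiE intro!: finite_PiE)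
  have fin: "finite bases" by (simp add: bases_def finite_positions)
  have fin_steps: "finite (steps b)" for b
  proof (rule finite_subset)
    show "steps b \<subseteq> {..<n}"
    proof
      fix t assume "t \<in> steps b"
      then have "(\<lambda>l\<in>{..<d}. b l + t) \<in> positions d (\<lambda>_. n)"
        by (simp add: steps_def X_def)
      \<comment> \<open>Coordinate 0 exists because \<open>d \<ge> 1\<close>, and there
        \<open>t \<le> b 0 + t < n\<close>.\<close>
      from positions_memD[OF this, of 0] show "t \<in> {..<n}" using \<open>d \<ge> 1\<close> by simp
    qed
  qed simp
  have card_steps: "card (steps b) \<le> k - 1" for b
  proof (rule ccontr)
    assume "\<not> card (steps b) \<le> k - 1"
    then have "k \<le> card (steps b)" by simp
    then obtain T where T: "T \<subseteq> steps b" "card T = k"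
      using obtain_subset_with_card_n by metis
    have "contains d A (identity_matrix d k)"
      using T fin_steps[of b]
      by (intro contains_identity[OF A \<open>d \<ge> 1\<close>, of T k b]) (auto simp: steps_def X_def intro: finite_subset)
    with avoids show False by simp
  qed
  have "X \<subseteq> (\<Union>b\<in>bases. (\<lambda>t. \<lambda>l\<in>{..<d}. b l + t) ` steps b)"
  proof
    fix i assume i: "i \<in> X"
    \<comment> \<open>Subtracting the smallest coordinate slides \<open>i\<close> down its line
      until some coordinate, namely \<open>l0\<close> below, becomes 0.\<close>
    define t where "t = Min (i ` {..<d})"
    define b where "b = (\<lambda>l\<in>{..<d}. i l - t)"
    have t_le: "t \<le> i l" if "l < d" for l
      using that by (simp add: t_def)
    have "t \<in> i ` {..<d}"
      unfolding t_def using \<open>d \<ge> 1\<close> by (intro Min_in) (auto simp: lessThan_empty_iff)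
    then obtain l0 where l0: "l0 < d" "i l0 = t" by auto
    have in_pos: "i \<in> positions d (\<lambda>_. n)" using i by (simp add: X_def)
    have eq: "i = (\<lambda>l\<in>{..<d}. b l + t)"
      using in_pos t_le by (auto simp: b_def positions_def PiE_def extensional_def)
    have "b \<in> positions d (\<lambda>_. n)"
      unfolding positions_def b_def using positions_memD[OF in_pos] by (auto intro: le_less_trans[OF diff_le_self])
    moreover have "b l0 \<notin> {1..<n}" using l0 by (simp add: b_def)
    then have "b \<notin> (\<Pi>\<^sub>E l\<in>{..<d}. {1..<n})"
      using l0(1) PiE_mem lessThan_iff by metis
    ultimately have "b \<in> bases" by (simp add: bases_def)
    moreover have "t \<in> steps b" using i eq by (simp add: steps_def)
    ultimately show "i \<in> (\<Union>b\<in>bases. (\<lambda>t. \<lambda>l\<in>{..<d}. b l + t) ` steps b)"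
      using eq by blast
  qed
  then have "card X \<le> card (\<Union>b\<in>bases. (\<lambda>t. \<lambda>l\<in>{..<d}. b l + t) ` steps b)"
    using fin fin_steps by (intro card_mono) auto
  also have "\<dots> \<le> (\<Sum>b\<in>bases. card ((\<lambda>t. \<lambda>l\<in>{..<d}. b l + t) ` steps b))"
    by (rule card_UN_le[OF fin])
  also have "\<dots> \<le> (\<Sum>b\<in>bases. k - 1)"
    by (intro sum_mono order_trans[OF card_image_le[OF fin_steps] card_steps])
  also have "\<dots> = (n ^ d - (n - 1) ^ d) * (k - 1)"
    by (simp add: card_bases)
  finally show ?thesis
    by (simp add: num_ones_def X_def zero_one_matricesD(2)[OF A])
qed

lemma identity_matrix_origin:
  assumes "k \<ge> 1"
  shows "(\<lambda>l\<in>{..<d}. 0) \<in> positions d (dims (identity_matrix d k))"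
    and "entry (identity_matrix d k) (\<lambda>l\<in>{..<d}. 0) = 1"
  using assms by (auto simp: identity_matrix_def positions_def)

text \<open>The quotient is bounded for every \<open>n \<ge> 1\<close>, since
  \<open>n ^ d - (n - 1) ^ d\<close> is at most \<open>d * n ^ (d - 1)\<close>.\<close>

lemma upper_limit_identity_le:
  assumes "d \<ge> 1" "k \<ge> 1"
  shows "upper_limit (identity_matrix d k) d \<le> ereal (real d * (real k - 1))"
  unfolding upper_limit_def
proof (rule Limsup_bounded)
  let ?f = "\<lambda>n. extremal n (identity_matrix d k) d"
  have "ereal (real (?f n) / real n ^ (d - 1)) \<le> ereal (real d * (real k - 1))" if n: "n \<ge> 1" for n
  proof -
    have "?f n \<le> (n ^ d - (n - 1) ^ d) * (k - 1)"
      using num_ones_le_if_avoids_identity assms n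
      by (intro extremal_le[OF identity_matrix_origin]) auto
    then have "real (?f n) \<le> real ((n ^ d - (n - 1) ^ d) * (k - 1))"
      by (rule of_nat_mono)
    also have "\<dots> = (real n ^ d - (real n - 1) ^ d) * (real k - 1)"
      using n \<open>k \<ge> 1\<close> by (simp add: of_nat_diff power_mono)
    also have "\<dots> \<le> (real d * real n ^ (d - 1)) * (real k - 1)"
      using power_diff_le[of "real n - 1" "real n" d] n \<open>k \<ge> 1\<close> by (intro mult_right_mono) auto
    finally show ?thesis
      using n by (simp add: divide_le_eq mult_ac)
  qed
  then show "\<forall>\<^sub>F n in sequentially.
      ereal (real (?f n) / real n ^ (d - 1)) \<le> ereal (real d * (real k - 1))"
    using eventually_ge_at_top[of 1] by (rule eventually_mono[rotated])
qed

section \<open>Permutation matrices and tuple permutation matrices\<close>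

lemma permutation_matrix_obtain_one:
  assumes "permutation_matrix d k P" "d \<ge> 1" "k \<ge> 1"
  obtains p where "p \<in> positions d (\<lambda>_. k)" "entry P p = 1"
proof -
  have P: "P \<in> zero_one_matrices d (\<lambda>_. k)"
    using assms(1) by (simp add: permutation_matrix_def)
  have "\<exists>!i. i \<in> cross_section d P 0 0 \<and> entry P i \<noteq> 0"
    using assms by (simp add: permutation_matrix_def)
  then obtain p where "p \<in> cross_section d P 0 0" "entry P p \<noteq> 0" by blast
  then show thesis
    using that[of p] zero_one_matricesD(2)[OF P] zero_one_matricesD(3)[OF P, of p]
    by (auto simp: cross_section_def)
qed

lemma lower_limit_permutation_ge:
  assumes P: "permutation_matrix d k P" and "d \<ge> 1" "k \<ge> 1"
  shows "lower_limit P d \<ge> ereal (real d * (real k - 1))"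
proof -
  have Z: "P \<in> zero_one_matrices d (\<lambda>_. k)"
    using P by (simp add: permutation_matrix_def)
  obtain p where "p \<in> positions d (\<lambda>_. k)" "entry P p = 1"
    using permutation_matrix_obtain_one[OF assms] .
  then show ?thesis
    using lower_limit_ge[of p d P k] zero_one_matricesD[OF Z] \<open>k \<ge> 1\<close> by simp
qed

text \<open>The sides of \<open>P\<close> are \<open>k * q l \<ge> k\<close>, and each one of
  \<open>P'\<close> expands to a nonempty block of ones, so \<open>lower_limit_ge\<close>
  applies.\<close>

lemma lower_limit_tuple_permutation_ge:
  assumes P': "permutation_matrix d k P'" and P: "tuple_permutation_matrix d P' P"
    and "d \<ge> 1" "k \<ge> 1"
  shows "lower_limit P d \<ge> ereal (real d * (real k - 1))"
proof -
  obtain q l0 where q: "q l0 > 1" "\<forall>j<d. j \<noteq> l0 \<longrightarrow> q j = 1"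
    and P_eq: "P = kronecker d P' (ones_matrix d q)"
    using P unfolding tuple_permutation_matrix_def by blast
  have q_pos: "q l \<ge> 1" if "l < d" for l
    using q that by (cases "l = l0") auto
  have Z: "P' \<in> zero_one_matrices d (\<lambda>_. k)"
    using P' by (simp add: permutation_matrix_def)
  obtain p where p: "p \<in> positions d (\<lambda>_. k)" "entry P' p = 1"
    using permutation_matrix_obtain_one[OF P' assms(3,4)] .
  have dims: "dims P l = k * q l" if "l < d" for l
    using that zero_one_matricesD(1)[OF Z] by (simp add: P_eq kronecker_def ones_matrix_def)
  \<comment> \<open>The first corner of the block replacing the one at \<open>p\<close>: division by
    \<open>q l\<close> gives back \<open>p l\<close>, and the offset is 0.\<close>
  define i where "i = (\<lambda>l\<in>{..<d}. p l * q l)"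
  have i: "i \<in> positions d (\<lambda>l. k * q l)"
    using positions_memD[OF p(1)] q_pos by (auto simp: i_def positions_def Suc_le_eq)
  have "positions d (\<lambda>l. dims P' l * dims (ones_matrix d q) l) = positions d (\<lambda>l. k * q l)"
    by (rule positions_cong) (simp add: zero_one_matricesD(1)[OF Z] ones_matrix_def)
  moreover have "(\<lambda>l\<in>{..<d}. i l div dims (ones_matrix d q) l) = p"
  proof
    fix l show "(\<lambda>l\<in>{..<d}. i l div dims (ones_matrix d q) l) l = p l"
      using p(1) q_pos[of l]
      by (cases "l < d") (auto simp: i_def ones_matrix_def positions_def PiE_def extensional_def)
  qed
  moreover have "(\<lambda>l\<in>{..<d}. i l mod dims (ones_matrix d q) l) \<in> positions d q"
    using q_pos by (auto simp: i_def ones_matrix_def positions_def Suc_le_eq)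
  ultimately have "entry P i = 1"
    using i p(2) by (simp add: P_eq kronecker_def) (simp add: ones_matrix_def)
  moreover have "i \<in> positions d (dims P)"
    using i dims positions_cong by metis
  ultimately show ?thesis
    using dims q_pos \<open>k \<ge> 1\<close> by (intro lower_limit_ge[of i]) auto
qed

theorem theorem4p5:
  fixes d k :: nat and P :: matrix
  assumes "d \<ge> 1" and "k \<ge> 1"
  shows "(permutation_matrix d k P \<or>
            (\<exists>P'. permutation_matrix d k P' \<and> tuple_permutation_matrix d P' P)
          \<longrightarrow> lower_limit P d \<ge> ereal (real d * (real k - 1))) \<and>
         (P = identity_matrix d k
          \<longrightarrow> lower_limit P d = ereal (real d * (real k - 1)) \<and>
              upper_limit P d = ereal (real d * (real k - 1)))"
proof (intro conjI impI)
  assume "permutation_matrix d k P \<or>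
    (\<exists>P'. permutation_matrix d k P' \<and> tuple_permutation_matrix d P' P)"
  then show "lower_limit P d \<ge> ereal (real d * (real k - 1))"
    using lower_limit_permutation_ge lower_limit_tuple_permutation_ge assms by blast
next
  assume P: "P = identity_matrix d k"
  \<comment> \<open>The one at the origin gives the lower bound directly, without showing that the
    identity is a permutation matrix.\<close>
  have "lower_limit P d \<ge> ereal (real d * (real k - 1))"
    unfolding P using \<open>k \<ge> 1\<close>
    by (intro lower_limit_ge[OF identity_matrix_origin]) (auto simp: identity_matrix_def)
  moreover have "upper_limit P d \<le> ereal (real d * (real k - 1))"
    unfolding P using assms by (rule upper_limit_identity_le)
  moreover have "lower_limit P d \<le> upper_limit P d"
    unfolding lower_limit_def upper_limit_def by (rule Liminf_le_Limsup) simp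
  ultimately show "lower_limit P d = ereal (real d * (real k - 1))"
    and "upper_limit P d = ereal (real d * (real k - 1))" by auto
qed

end
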